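(* A Tychonoff space $X$ is sequentially Ascoli if, and only if, each separately continuous $k$-continuous function $\Phi:X\times \mathbf{s}\to \mathbb{R}$ is continuous, where $\mathbf{s}=\{\tfrac{1}{n}\}_{n\in\mathbb{N}}\cup\{0\}$ has the topology induced from $\mathbb{R}$.
   Context: All spaces are assumed to be Tychonoff. $C_k(X)$ denotes the space $C(X)$ of all continuous real-valued functions on $X$ with the compact-open topology. A Tychonoff space $X$ is sequentially Ascoli if every convergent sequence in $C_k(X)$ is equicontinuous. A subset $H\subseteq C(X)$ is equicontinuous if for every $x\in X$ and each $\varepsilon>0$ there is an open neighborhood $U$ of $x$ such that $|f(x')-f(x)|<\varepsilon$ for all $x'\in U$ and $f\in H$. A function $f:Z\to\mathbb{R}$ on a space $Z$ is $k$-continuous if its restriction to every compact subset of $Z$ is continuous. A function $\Phi:X\times \mathbf{s}\to\mathbb{R}$ is separately continuous if $\Phi(x,\cdot)$ is continuous on $\mathbf{s}$ for every $x\in X$ and $\Phi(\cdot,t)$ is continuous on $X$ for every $t\in \mathbf{s}$. *)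

theory Defs
  imports "HOL-Analysis.Analysis"
begin

text \<open>Spaces are abstract topologies, so that all of the notions below apply to every space
  (including the empty one) and to subspaces and products.\<close>

definition tychonoff_space :: "'a topology \<Rightarrow> bool" where
  "tychonoff_space X \<longleftrightarrow> completely_regular_space X \<and> Hausdorff_space X"

text \<open>The elements of \<open>C(X)\<close> are functions on the points of \<open>X\<close> only; extensionality identifies
  HOL functions that differ merely outside \<open>topspace X\<close>.\<close>

definition cont_funs :: "'a topology \<Rightarrow> ('a \<Rightarrow> real) set" where
  "cont_funs X = {f. continuous_map X euclideanreal f} \<inter> extensional (topspace X)"

text \<open>The sets \<open>[K; U]\<close> form a subbase; the choice \<open>K = {}\<close> yields all of \<open>C(X)\<close>, so the
  carrier of the generated topology is \<open>C(X)\<close>.\<close>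

definition compact_open_topology :: "'a topology \<Rightarrow> ('a \<Rightarrow> real) topology" where
  "compact_open_topology X =
     topology_generated_by {{f \<in> cont_funs X. f ` K \<subseteq> U} | K U. compactin X K \<and> open U}"

lemma topspace_compact_open_topology [simp]:
  "topspace (compact_open_topology X) = cont_funs X"
proof -
  have "cont_funs X \<in> {{f \<in> cont_funs X. f ` K \<subseteq> U} | K U. compactin X K \<and> open U}"
    by (rule CollectI, rule exI[of _ "{}"], rule exI[of _ UNIV]) auto
  then show ?thesis
    unfolding compact_open_topology_def topology_generated_by_topspace by blast
qed

definition equicontinuous_in :: "'a topology \<Rightarrow> ('a \<Rightarrow> real) set \<Rightarrow> bool" where
  "equicontinuous_in X H \<longleftrightarrow>
     (\<forall>x\<in>topspace X. \<forall>\<epsilon>>0. \<exists>U. openin X U \<and> x \<in> U \<and> (\<forall>x'\<in>U. \<forall>f\<in>H. \<bar>f x' - f x\<bar> < \<epsilon>))"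

text \<open>The first condition is needed because \<open>limitin\<close> only constrains a sequence eventually.\<close>

definition sequentially_ascoli_space :: "'a topology \<Rightarrow> bool" where
  "sequentially_ascoli_space X \<longleftrightarrow>
     (\<forall>f g. (\<forall>n::nat. f n \<in> cont_funs X) \<and> limitin (compact_open_topology X) f g sequentially
        \<longrightarrow> equicontinuous_in X (range f))"

definition k_continuous_map :: "'a topology \<Rightarrow> ('a \<Rightarrow> real) \<Rightarrow> bool" where
  "k_continuous_map Z f \<longleftrightarrow>
     (\<forall>K. compactin Z K \<longrightarrow> continuous_map (subtopology Z K) euclideanreal f)"

definition separately_continuous_map ::
    "'a topology \<Rightarrow> 'b topology \<Rightarrow> ('a \<times> 'b \<Rightarrow> real) \<Rightarrow> bool" where
  "separately_continuous_map X Y \<Phi> \<longleftrightarrow>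
     (\<forall>x\<in>topspace X. continuous_map Y euclideanreal (\<lambda>t. \<Phi> (x, t))) \<and>
     (\<forall>t\<in>topspace Y. continuous_map X euclideanreal (\<lambda>x. \<Phi> (x, t)))"

definition conv_seq_space :: "real topology" where
  "conv_seq_space = top_of_set ({1 / real n | n. n \<ge> 1} \<union> {0})"

end

theory Submission
  imports Defs
begin

text \<open>
  A function \<open>\<Phi>\<close> on \<open>X \<times> s\<close> is the same thing as a sequence \<open>f\<^sub>n = \<Phi>(\<cdot>, 1/(n+1))\<close> together with a
  candidate limit \<open>g = \<Phi>(\<cdot>, 0)\<close>. By the tube lemma, \<open>k\<close>-continuity of \<open>\<Phi>\<close> gives \<open>f\<^sub>n \<rightarrow> g\<close> in the
  compact-open topology, and continuity of \<open>\<Phi>\<close> gives equicontinuity of the \<open>f\<^sub>n\<close> because \<open>s\<close> is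
  compact. Conversely, convergence in the compact-open topology makes \<open>\<Phi>\<close> continuous over every
  compact \<open>P\<close> (apply it to the compact sets \<open>{y \<in> P. \<bar>g y - g x\<bar> \<le> \<epsilon>}\<close>, which are neighbourhoods
  of \<open>x\<close> in \<open>P\<close>), and equicontinuity of the \<open>f\<^sub>n\<close> makes \<open>\<Phi>\<close> continuous at the points of
  \<open>X \<times> {0}\<close>; the remaining points of \<open>s\<close> are isolated.
\<close>

section \<open>The convergent sequence with its limit\<close>

text \<open>Indexing by \<open>Suc n\<close> matches sequences over \<open>nat\<close>, which start
  at 0, and keeps every denominator nonzero.\<close>

lemma topspace_conv_seq_space:
  "topspace conv_seq_space = insert 0 (range (\<lambda>n. 1 / real (Suc n)))"
proof -
  have "{1 / real n | n. n \<ge> 1} = range (\<lambda>n. 1 / real (Suc n))"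
    by (auto simp del: of_nat_Suc) (metis Suc_pred' less_eq_Suc_le One_nat_def rangeI)
  then show ?thesis
    by (simp add: conv_seq_space_def)
qed

lemma zero_in_conv_seq_space: "0 \<in> topspace conv_seq_space"
  and inverse_Suc_in_conv_seq_space: "1 / real (Suc n) \<in> topspace conv_seq_space"
  by (auto simp: topspace_conv_seq_space)

lemma compact_space_conv_seq_space: "compact_space conv_seq_space"
proof -
  have "compact (insert 0 (range (\<lambda>n. 1 / real (Suc n))))"
    using compact_sequence_with_limit LIMSEQ_Suc[OF lim_1_over_n] by blast
  then show ?thesis
    using topspace_conv_seq_space
    by (simp add: conv_seq_space_def compact_space_subtopology)
qed

lemma openin_conv_seq_space:
  "open T \<Longrightarrow> openin conv_seq_space (topspace conv_seq_space \<inter> T)"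
  by (auto simp: conv_seq_space_def openin_open)

lemma openin_conv_seq_space_isolated: "openin conv_seq_space {1 / real (Suc n)}"
proof -
  \<comment> \<open>The endpoints are reciprocals of half-integers: \<open>1 / real (Suc m)\<close>
    lies between them only if \<open>m + 1\<close> is strictly between \<open>n + 1/2\<close> and
    \<open>n + 3/2\<close>.\<close>
  define T where "T = {1 / (real n + 3/2) <..< 1 / (real n + 1/2)}"
  have "m = n" if "1 / real (Suc m) \<in> T" for m
  proof -
    have "real m < real n + 1" "real n < real m + 1"
      using that by (auto simp: T_def field_simps)
    then show ?thesis by linarith
  qed
  moreover have "1 / real (Suc n) \<in> T" "0 \<notin> T"
    by (auto simp: T_def field_simps)
  ultimately have "topspace conv_seq_space \<inter> T = {1 / real (Suc n)}"
    unfolding topspace_conv_seq_space by blast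
  then show ?thesis
    using openin_conv_seq_space[of T] by (simp add: T_def)
qed

lemma conv_seq_space_nhd_zero:
  assumes "openin conv_seq_space V" "0 \<in> V"
  shows "\<exists>N. \<forall>n\<ge>N. 1 / real (Suc n) \<in> V"
proof -
  obtain T where T: "open T" "V = topspace conv_seq_space \<inter> T"
    using assms(1) by (auto simp: conv_seq_space_def openin_open)
  then have "\<forall>\<^sub>F n in sequentially. 1 / real (Suc n) \<in> T"
    using LIMSEQ_Suc[OF lim_1_over_n] assms(2) topological_tendstoD by (metis IntD2)
  then show ?thesis
    using T inverse_Suc_in_conv_seq_space by (auto simp: eventually_sequentially)
qed

text \<open>Over an isolated point of the sequence, continuity of the section is enough, so only the
  points over 0 need the joint estimate \<open>zero\<close>. The space \<open>Y\<close> is arbitrary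
  because it will be both \<open>X\<close> itself and a compact subspace of
  \<open>X\<close>.\<close>

lemma continuous_map_prod_conv_seq_space:
  fixes \<Phi> :: "'a \<times> real \<Rightarrow> real"
  assumes cont: "\<And>t. t \<in> topspace conv_seq_space \<Longrightarrow> continuous_map Y euclideanreal (\<lambda>x. \<Phi> (x, t))"
    and zero: "\<And>x e. x \<in> topspace Y \<Longrightarrow> e > 0 \<Longrightarrow>
      \<exists>U N. openin Y U \<and> x \<in> U \<and> (\<forall>y\<in>U. \<forall>n\<ge>N. \<bar>\<Phi> (y, 1 / real (Suc n)) - \<Phi> (x, 0)\<bar> < e)"
  shows "continuous_map (prod_topology Y conv_seq_space) euclideanreal \<Phi>"
proof -
  have nhd: "openin Y {y \<in> topspace Y. \<Phi> (y, t) \<in> V}" if "open V" "t \<in> topspace conv_seq_space" for V t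
    using openin_continuous_map_preimage[OF cont[OF that(2)]] that(1) by simp
  have "openin (prod_topology Y conv_seq_space)
          {z \<in> topspace (prod_topology Y conv_seq_space). \<Phi> z \<in> V}" if V: "open V" for V
    unfolding openin_prod_topology_alt
  proof (intro allI impI)
    fix x t
    assume "(x, t) \<in> {z \<in> topspace (prod_topology Y conv_seq_space). \<Phi> z \<in> V}"
    then have x: "x \<in> topspace Y" and t: "t \<in> topspace conv_seq_space" and xt: "\<Phi> (x, t) \<in> V"
      by auto
    show "\<exists>A B. openin Y A \<and> openin conv_seq_space B \<and> x \<in> A \<and> t \<in> B \<and>
            A \<times> B \<subseteq> {z \<in> topspace (prod_topology Y conv_seq_space). \<Phi> z \<in> V}"
    proof (cases "t = 0")
      case True
      obtain e where e: "e > 0" "ball (\<Phi> (x, 0)) e \<subseteq> V"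
        using V xt True open_contains_ball by blast
      obtain U N where U: "openin Y U" "x \<in> U"
        and UN: "\<And>y n. y \<in> U \<Longrightarrow> n \<ge> N \<Longrightarrow> \<bar>\<Phi> (y, 1 / real (Suc n)) - \<Phi> (x, 0)\<bar> < e"
        using zero[OF x e(1)] by blast
      \<comment> \<open>The estimate on \<open>U\<close> covers only the points
        \<open>1 / real (Suc n)\<close>; the second set in \<open>?A\<close> takes care of the
        section at 0. Apart from 0, \<open>?B\<close> contains only points with
        \<open>n > N\<close>.\<close>
      let ?A = "U \<inter> {y \<in> topspace Y. \<Phi> (y, 0) \<in> V}"
      let ?B = "topspace conv_seq_space \<inter> {..< 1 / real (Suc N)}"
      have "\<Phi> (y, s) \<in> V" if y: "y \<in> ?A" and s: "s \<in> ?B" for y s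
      proof (cases "s = 0")
        case False
        then obtain n where n: "s = 1 / real (Suc n)"
          using s by (auto simp: topspace_conv_seq_space)
        then have "inverse (real (Suc n)) < inverse (real (Suc N))"
          using s by (simp add: inverse_eq_divide)
        then have "N < n"
          by (simp add: inverse_less_iff_less del: of_nat_Suc)
        then have "\<Phi> (y, s) \<in> ball (\<Phi> (x, 0)) e"
          using UN[of y n] y n by (simp add: dist_real_def abs_minus_commute)
        then show ?thesis using e by blast
      qed (use y in auto)
      moreover have "openin Y ?A"
        using U nhd[OF V zero_in_conv_seq_space] by blast
      moreover have "openin conv_seq_space ?B"
        by (rule openin_conv_seq_space) simp
      ultimately show ?thesis
        using U x xt True t by (intro exI[of _ ?A] exI[of _ ?B]) auto
    next
      case False
      then obtain n where n: "t = 1 / real (Suc n)"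
        using t by (auto simp: topspace_conv_seq_space)
      then have "openin conv_seq_space {t}"
        using openin_conv_seq_space_isolated by blast
      then show ?thesis
        using nhd[OF V t] x xt t
        by (intro exI[of _ "{y \<in> topspace Y. \<Phi> (y, t) \<in> V}"] exI[of _ "{t}"]) auto
    qed
  qed
  then show ?thesis
    by (simp add: continuous_map_def)
qed

section \<open>Convergence in the compact-open topology\<close>

text \<open>Convergence can be tested on the subbase, since the property "if \<open>g\<close> is in
  \<open>W\<close>, then eventually \<open>f n\<close> is in \<open>W\<close>" passes to finite
  intersections and arbitrary unions.\<close>

lemma limitin_compact_open_topology:
  assumes f: "\<And>n. f n \<in> cont_funs X"
  shows "limitin (compact_open_topology X) f g F \<longleftrightarrow>
    g \<in> cont_funs X \<and>
    (\<forall>K U. compactin X K \<and> open U \<and> g ` K \<subseteq> U \<longrightarrow> (\<forall>\<^sub>F n in F. f n ` K \<subseteq> U))"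
    (is "?lim \<longleftrightarrow> ?cont \<and> ?conv")
proof
  assume lim: ?lim
  then have g: ?cont
    by (metis limitin_topspace topspace_compact_open_topology)
  have "\<forall>\<^sub>F n in F. f n ` K \<subseteq> U" if "compactin X K" "open U" "g ` K \<subseteq> U" for K U
  proof -
    have "openin (compact_open_topology X) {h \<in> cont_funs X. h ` K \<subseteq> U}"
      unfolding compact_open_topology_def
      by (rule topology_generated_by_Basis) (use that in blast)
    then have "\<forall>\<^sub>F n in F. f n \<in> {h \<in> cont_funs X. h ` K \<subseteq> U}"
      using lim g that by (auto simp: limitin_def)
    then show ?thesis
      by eventually_elim simp
  qed
  with g show "?cont \<and> ?conv" by blast
next
  assume R: "?cont \<and> ?conv"
  define S where "S = {{f \<in> cont_funs X. f ` K \<subseteq> U} | K U. compactin X K \<and> open U}"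
  have "g \<in> W \<longrightarrow> (\<forall>\<^sub>F n in F. f n \<in> W)" if "generate_topology_on S W" for W
    using that
  proof induction
    case (Int a b)
    then show ?case by (auto intro: eventually_conj)
  next
    case (UN \<K>)
    show ?case
    proof
      assume "g \<in> \<Union>\<K>"
      then obtain k where "k \<in> \<K>" "g \<in> k" by blast
      with UN.IH have "\<forall>\<^sub>F n in F. f n \<in> k" by blast
      then show "\<forall>\<^sub>F n in F. f n \<in> \<Union>\<K>"
        by eventually_elim (use \<open>k \<in> \<K>\<close> in blast)
    qed
  next
    case (Basis s)
    then obtain K U where "s = {f \<in> cont_funs X. f ` K \<subseteq> U}" "compactin X K" "open U"
      by (auto simp: S_def)
    then show ?case
      using R f by auto
  qed simp
  moreover have "openin (compact_open_topology X) W \<longleftrightarrow> generate_topology_on S W" for W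
    by (simp add: compact_open_topology_def S_def openin_topology_generated_by_iff)
  ultimately show ?lim
    using R by (simp add: limitin_def)
qed

lemma limitin_compact_open_topology_of_k_continuous:

  \<comment> \<open>Functions on the product as convergent sequences\<close>
  fixes \<Phi> :: "'a \<times> real \<Rightarrow> real"
  assumes sep: "separately_continuous_map X conv_seq_space \<Phi>"
    and k: "k_continuous_map (prod_topology X conv_seq_space) \<Phi>"
  defines "f \<equiv> \<lambda>n. restrict (\<lambda>x. \<Phi> (x, 1 / real (Suc n))) (topspace X)"
    and "g \<equiv> restrict (\<lambda>x. \<Phi> (x, 0)) (topspace X)"
  shows "\<And>n. f n \<in> cont_funs X"
    and "limitin (compact_open_topology X) f g sequentially"
proof -
  have restr: "restrict (\<lambda>x. \<Phi> (x, t)) (topspace X) \<in> cont_funs X"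
    if "t \<in> topspace conv_seq_space" for t
    using sep that by (auto simp: cont_funs_def separately_continuous_map_def
        intro: continuous_map_eq)
  show f: "f n \<in> cont_funs X" for n
    unfolding f_def by (rule restr[OF inverse_Suc_in_conv_seq_space])
  have "\<forall>\<^sub>F n in sequentially. f n ` K \<subseteq> U"
    if K: "compactin X K" and U: "open U" "g ` K \<subseteq> U" for K U
  proof -
    let ?Z = "prod_topology (subtopology X K) conv_seq_space"
    have KX: "K \<subseteq> topspace X"
      using K compactin_subset_topspace by blast
    \<comment> \<open>The compact set to which \<open>k\<close> is applied is the full rectangle
      over \<open>K\<close>; the subspace topology on it is again a product, as the tube lemma
      requires.\<close>
    have "compactin (prod_topology X conv_seq_space) (K \<times> topspace conv_seq_space)"
      using K compact_space_conv_seq_space by (simp add: compactin_Times compact_space_def)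
    then have "continuous_map ?Z euclideanreal \<Phi>"
      using k by (simp add: k_continuous_map_def prod_topology_subtopology)
    then have W: "openin ?Z {z \<in> topspace ?Z. \<Phi> z \<in> U}"
      using U by (intro openin_continuous_map_preimage) auto
    have "K \<times> {0} \<subseteq> {z \<in> topspace ?Z. \<Phi> z \<in> U}"
      using U KX zero_in_conv_seq_space by (auto simp: g_def)
    from tube_lemma_left[OF W _ zero_in_conv_seq_space this]
    obtain A B where B: "openin conv_seq_space B" "0 \<in> B" and KA: "K \<subseteq> A"
      and AB: "A \<times> B \<subseteq> {z \<in> topspace ?Z. \<Phi> z \<in> U}"
      using K by (auto simp: compactin_subtopology simp del: topspace_prod_topology)
    obtain N where N: "\<forall>n\<ge>N. 1 / real (Suc n) \<in> B"
      using conv_seq_space_nhd_zero[OF B] by blast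
    have "f n ` K \<subseteq> U" if "n \<ge> N" for n
    proof
      fix r assume "r \<in> f n ` K"
      then obtain y where y: "y \<in> K" "r = \<Phi> (y, 1 / real (Suc n))"
        using KX by (auto simp: f_def)
      then have "(y, 1 / real (Suc n)) \<in> A \<times> B"
        using KA N that by blast
      then show "r \<in> U"
        using AB y by blast
    qed
    then show ?thesis
      by (auto simp: eventually_sequentially)
  qed
  moreover have "g \<in> cont_funs X"
    unfolding g_def by (rule restr[OF zero_in_conv_seq_space])
  ultimately show "limitin (compact_open_topology X) f g sequentially"
    using f by (subst limitin_compact_open_topology) blast+
qed

text \<open>Near a point over 0 the error splits in two halves: equicontinuity moves
  \<open>y\<close> to \<open>x\<close> uniformly in \<open>n\<close>, then continuity of the section
  at \<open>x\<close> moves \<open>1 / real (Suc n)\<close> to 0.\<close>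

lemma continuous_map_of_equicontinuous:
  fixes \<Phi> :: "'a \<times> real \<Rightarrow> real"
  assumes sep: "separately_continuous_map X conv_seq_space \<Phi>"
    and equi: "equicontinuous_in X
      (range (\<lambda>n. restrict (\<lambda>x. \<Phi> (x, 1 / real (Suc n))) (topspace X)))"
  shows "continuous_map (prod_topology X conv_seq_space) euclideanreal \<Phi>"
proof (rule continuous_map_prod_conv_seq_space)
  show "continuous_map X euclideanreal (\<lambda>x. \<Phi> (x, t))" if "t \<in> topspace conv_seq_space" for t
    using sep that by (simp add: separately_continuous_map_def)
next
  fix x and e :: real
  assume x: "x \<in> topspace X" and e: "e > 0"
  obtain U where U: "openin X U" "x \<in> U"
    and close: "\<And>y n. y \<in> U \<Longrightarrow>
      \<bar>restrict (\<lambda>x. \<Phi> (x, 1 / real (Suc n))) (topspace X) y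
        - restrict (\<lambda>x. \<Phi> (x, 1 / real (Suc n))) (topspace X) x\<bar> < e / 2"
    using equi x half_gt_zero[OF e] unfolding equicontinuous_in_def by (metis rangeI)
  have "continuous_map conv_seq_space euclideanreal (\<lambda>t. \<Phi> (x, t))"
    using sep x by (simp add: separately_continuous_map_def)
  then have "openin conv_seq_space
      {t \<in> topspace conv_seq_space. \<Phi> (x, t) \<in> ball (\<Phi> (x, 0)) (e / 2)}"
    by (rule openin_continuous_map_preimage) simp
  then obtain N where
    N: "\<forall>n\<ge>N. 1 / real (Suc n) \<in> {t \<in> topspace conv_seq_space. \<Phi> (x, t) \<in> ball (\<Phi> (x, 0)) (e / 2)}"
    using conv_seq_space_nhd_zero[OF _ CollectI] zero_in_conv_seq_space e
    by (metis (no_types, lifting) centre_in_ball half_gt_zero)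
  have "\<bar>\<Phi> (y, 1 / real (Suc n)) - \<Phi> (x, 0)\<bar> < e" if "y \<in> U" "n \<ge> N" for y n
  proof -
    have "y \<in> topspace X"
      using U that openin_subset by blast
    then have "\<bar>\<Phi> (y, 1 / real (Suc n)) - \<Phi> (x, 1 / real (Suc n))\<bar> < e / 2"
      using close[OF that(1), of n] x by simp
    moreover have "\<bar>\<Phi> (x, 0) - \<Phi> (x, 1 / real (Suc n))\<bar> < e / 2"
      using N that by (auto simp: dist_real_def)
    ultimately show ?thesis by linarith
  qed
  then show "\<exists>U N. openin X U \<and> x \<in> U \<and> (\<forall>y\<in>U. \<forall>n\<ge>N. \<bar>\<Phi> (y, 1 / real (Suc n)) - \<Phi> (x, 0)\<bar> < e)"
    using U by blast
qed

section \<open>Convergent sequences as functions on the product\<close>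

text \<open>Here \<open>inv\<close> recovers the index \<open>n\<close> from
  \<open>t = 1 / real (Suc n)\<close>. Its arbitrary values at other nonzero \<open>t\<close> do not
  matter, as such \<open>t\<close> lie outside \<open>conv_seq_space\<close>.\<close>

definition seq_extension :: "(nat \<Rightarrow> 'a \<Rightarrow> real) \<Rightarrow> ('a \<Rightarrow> real) \<Rightarrow> 'a \<times> real \<Rightarrow> real" where
  "seq_extension f g = (\<lambda>(x, t). if t = 0 then g x else f (inv (\<lambda>n. 1 / real (Suc n)) t) x)"

lemma seq_extension_zero [simp]: "seq_extension f g (x, 0) = g x"
  by (simp add: seq_extension_def)

lemma seq_extension_inverse_Suc: "seq_extension f g (x, 1 / real (Suc n)) = f n x"
proof -
  have "inj (\<lambda>n. 1 / real (Suc n))"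
    by (auto intro!: injI)
  then have "inv (\<lambda>n. 1 / real (Suc n)) (1 / real (Suc n)) = n"
    by (rule inv_f_f)
  then show ?thesis
    by (simp add: seq_extension_def del: of_nat_Suc)
qed

lemma continuous_map_seq_extension_section:
  assumes "\<And>n. f n \<in> cont_funs X" "g \<in> cont_funs X" "t \<in> topspace conv_seq_space"
  shows "continuous_map X euclideanreal (\<lambda>x. seq_extension f g (x, t))"
  using assms
  by (auto simp: topspace_conv_seq_space cont_funs_def seq_extension_inverse_Suc simp del: of_nat_Suc)

lemma continuous_map_seq_extension_compact:
  assumes f: "\<And>n. f n \<in> cont_funs X"
    and lim: "limitin (compact_open_topology X) f g sequentially"
    and P: "compactin X P"
  shows "continuous_map (prod_topology (subtopology X P) conv_seq_space) euclideanreal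
    (seq_extension f g)"
proof (rule continuous_map_prod_conv_seq_space)
  have g: "g \<in> cont_funs X"
    using lim limitin_compact_open_topology[of f X g sequentially, OF f] by blast
  show "continuous_map (subtopology X P) euclideanreal (\<lambda>x. seq_extension f g (x, t))"
    if "t \<in> topspace conv_seq_space" for t
    by (rule continuous_map_from_subtopology)
      (rule continuous_map_seq_extension_section[OF f g that])
  fix x and e :: real
  assume x: "x \<in> topspace (subtopology X P)" and e: "e > 0"
  have PX: "topspace (subtopology X P) = P"
    using P by (intro topspace_subtopology_subset compactin_subset_topspace)
  have gP: "continuous_map (subtopology X P) euclideanreal g"
    using g by (simp add: cont_funs_def continuous_map_from_subtopology)
  \<comment> \<open>The closed ball makes \<open>K\<close> closed in \<open>P\<close>, hence
    compact, while the open ball makes \<open>U\<close> an open neighbourhood of \<open>x\<close>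
    inside \<open>K\<close>. As \<open>e / 2 < e\<close>, the image of \<open>K\<close> under
    \<open>g\<close> fits into the open ball of radius \<open>e\<close>, so convergence on
    \<open>K\<close> compares \<open>f n y\<close> directly with \<open>g x\<close>.\<close>
  define K where "K = {y \<in> P. g y \<in> cball (g x) (e / 2)}"
  define U where "U = {y \<in> P. g y \<in> ball (g x) (e / 2)}"
  have "closedin (subtopology X P) K"
    using closedin_continuous_map_preimage[OF gP, of "cball (g x) (e / 2)"]
    by (simp add: K_def PX del: topspace_subtopology)
  moreover have "compactin (subtopology X P) P"
    using P by (simp add: compactin_subtopology)
  ultimately have "compactin (subtopology X P) K"
    using closed_compactin[of _ P K] unfolding K_def by blast
  then have "compactin X K"
    by (simp add: compactin_subtopology)
  moreover have "g ` K \<subseteq> ball (g x) e"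
    using e by (auto simp: K_def)
  ultimately obtain N where N: "\<forall>n\<ge>N. f n ` K \<subseteq> ball (g x) e"
    using iffD1[OF limitin_compact_open_topology[of f X g sequentially, OF f] lim] open_ball
    unfolding eventually_sequentially by blast
  have "openin (subtopology X P) U"
    using openin_continuous_map_preimage[OF gP, of "ball (g x) (e / 2)"]
    by (simp add: U_def PX del: topspace_subtopology)
  moreover have "x \<in> U"
    using x e by (simp add: U_def PX del: topspace_subtopology)
  moreover have "\<bar>f n y - g x\<bar> < e" if "y \<in> U" "n \<ge> N" for y n
  proof -
    have "y \<in> K"
      using that by (auto simp: U_def K_def)
    then have "f n y \<in> ball (g x) e"
      using N that by blast
    then show ?thesis
      by (simp add: dist_real_def abs_minus_commute)
  qed
  ultimately show "\<exists>U N. openin (subtopology X P) U \<and> x \<in> U \<and>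
      (\<forall>y\<in>U. \<forall>n\<ge>N. \<bar>seq_extension f g (y, 1 / real (Suc n)) - seq_extension f g (x, 0)\<bar> < e)"
    unfolding seq_extension_inverse_Suc seq_extension_zero by blast
qed

text \<open>Every compact subset of the product lies in the rectangle over its projection to
  \<open>X\<close>, which is compact, so the case of rectangles suffices.\<close>

lemma k_continuous_map_seq_extension:
  assumes "\<And>n. f n \<in> cont_funs X" "limitin (compact_open_topology X) f g sequentially"
  shows "k_continuous_map (prod_topology X conv_seq_space) (seq_extension f g)"
  unfolding k_continuous_map_def
proof (intro allI impI)
  fix K
  assume K: "compactin (prod_topology X conv_seq_space) K"
  have "compactin X (fst ` K)"
    using K continuous_map_fst by (rule image_compactin)
  then have "continuous_map (subtopology (prod_topology X conv_seq_space)
      (fst ` K \<times> topspace conv_seq_space)) euclideanreal (seq_extension f g)"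
    using continuous_map_seq_extension_compact[OF assms] by (simp add: prod_topology_subtopology)
  moreover have "K \<subseteq> fst ` K \<times> topspace conv_seq_space"
    using compactin_subset_topspace[OF K] by force
  ultimately show "continuous_map (subtopology (prod_topology X conv_seq_space) K) euclideanreal
      (seq_extension f g)"
    by (rule continuous_map_from_subtopology_mono)
qed

lemma separately_continuous_map_seq_extension:
  assumes f: "\<And>n. f n \<in> cont_funs X"
    and lim: "limitin (compact_open_topology X) f g sequentially"
  shows "separately_continuous_map X conv_seq_space (seq_extension f g)"
  unfolding separately_continuous_map_def
proof (intro conjI ballI)
  have "g \<in> cont_funs X"
    using lim limitin_compact_open_topology[of f X g sequentially, OF f] by blast
  then show "continuous_map X euclideanreal (\<lambda>x. seq_extension f g (x, t))"
    if "t \<in> topspace conv_seq_space" for t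
    using continuous_map_seq_extension_section f that by blast
  fix x
  assume "x \<in> topspace X"
  \<comment> \<open>Continuity in \<open>t\<close> is the compact case for the singleton
    \<open>{x}\<close>, composed with the embedding of the sequence as the fibre over
    \<open>x\<close>.\<close>
  then have x: "compactin X {x}" and sub: "x \<in> topspace (subtopology X {x})"
    by auto
  have "continuous_map conv_seq_space (prod_topology (subtopology X {x}) conv_seq_space) (\<lambda>t. (x, t))"
    using sub by (simp add: continuous_map_pairwise o_def)
  from continuous_map_compose[OF this continuous_map_seq_extension_compact[OF f lim x]]
  show "continuous_map conv_seq_space euclideanreal (\<lambda>t. seq_extension f g (x, t))"
    by (simp add: o_def)
qed

section \<open>Equicontinuity from joint continuity\<close>

lemma equicontinuous_in_subset: "equicontinuous_in X H \<Longrightarrow> G \<subseteq> H \<Longrightarrow> equicontinuous_in X G"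
  unfolding equicontinuous_in_def by (meson subsetD)

lemma equicontinuous_in_sections:
  fixes \<Phi> :: "'a \<times> 'b \<Rightarrow> real"
  assumes Y: "compact_space Y" and cont: "continuous_map (prod_topology X Y) euclideanreal \<Phi>"
  shows "equicontinuous_in X ((\<lambda>t x. \<Phi> (x, t)) ` topspace Y)"
  unfolding equicontinuous_in_def
proof (intro ballI allI impI)
  fix x and e :: real
  assume x: "x \<in> topspace X" and e: "e > 0"
  \<comment> \<open>Subtracting the values on the fibre over \<open>x\<close> gives a continuous
    function that vanishes on that fibre. Compactness of \<open>Y\<close> then yields, by the tube
    lemma, one neighbourhood \<open>U\<close> of \<open>x\<close> that serves all \<open>t\<close>
    at once.\<close>
  let ?\<Psi> = "\<lambda>z. \<Phi> z - \<Phi> (x, snd z)"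
  have "continuous_map (prod_topology X Y) (prod_topology X Y) (\<lambda>z. (x, snd z))"
    using x by (simp add: continuous_map_pairwise o_def continuous_map_snd)
  from continuous_map_compose[OF this cont]
  have "continuous_map (prod_topology X Y) euclideanreal ?\<Psi>"
    using cont by (intro continuous_map_diff) (simp_all add: o_def)
  then have W: "openin (prod_topology X Y) {z \<in> topspace (prod_topology X Y). ?\<Psi> z \<in> ball 0 e}"
    by (rule openin_continuous_map_preimage) simp
  have "{x} \<times> topspace Y \<subseteq> {z \<in> topspace (prod_topology X Y). ?\<Psi> z \<in> ball 0 e}"
    using x e by auto
  from tube_lemma_right[OF W Y[unfolded compact_space_def] x this]
  obtain U V where U: "openin X U" "x \<in> U" and V: "topspace Y \<subseteq> V"
    and UV: "U \<times> V \<subseteq> {z \<in> topspace (prod_topology X Y). ?\<Psi> z \<in> ball 0 e}"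
    by (elim exE conjE)
  have "\<bar>\<Phi> (x', t) - \<Phi> (x, t)\<bar> < e" if "x' \<in> U" "t \<in> topspace Y" for x' t
    using subsetD[OF UV, of "(x', t)"] V that by auto
  then show "\<exists>U. openin X U \<and> x \<in> U \<and>
      (\<forall>x'\<in>U. \<forall>f\<in>(\<lambda>t x. \<Phi> (x, t)) ` topspace Y. \<bar>f x' - f x\<bar> < e)"
    using U by (intro exI[of _ U]) simp
qed

theorem theorem3p2:
  fixes X :: "'a topology"
  assumes "tychonoff_space X"
  shows "sequentially_ascoli_space X \<longleftrightarrow>
    (\<forall>\<Phi> :: 'a \<times> real \<Rightarrow> real.
       separately_continuous_map X conv_seq_space \<Phi> \<and>
       k_continuous_map (prod_topology X conv_seq_space) \<Phi>
       \<longrightarrow> continuous_map (prod_topology X conv_seq_space) euclideanreal \<Phi>)"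
proof (intro iffI allI impI)
  fix \<Phi> :: "'a \<times> real \<Rightarrow> real"
  assume X: "sequentially_ascoli_space X"
    and \<Phi>: "separately_continuous_map X conv_seq_space \<Phi> \<and>
       k_continuous_map (prod_topology X conv_seq_space) \<Phi>"
  then have sep: "separately_continuous_map X conv_seq_space \<Phi>"
    and k: "k_continuous_map (prod_topology X conv_seq_space) \<Phi>"
    by auto
  have "equicontinuous_in X (range f)"
    if "\<And>n. f n \<in> cont_funs X" "limitin (compact_open_topology X) f g sequentially" for f g
    using X that unfolding sequentially_ascoli_space_def by blast
  \<comment> \<open>The sequence is that of the restricted sections of \<open>\<Phi>\<close>; its
    limit is the restricted section at 0.\<close>
  note this[OF limitin_compact_open_topology_of_k_continuous[OF sep k]]
  then show "continuous_map (prod_topology X conv_seq_space) euclideanreal \<Phi>"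
    by (rule continuous_map_of_equicontinuous[OF sep])
next
  assume R: "\<forall>\<Phi> :: 'a \<times> real \<Rightarrow> real.
       separately_continuous_map X conv_seq_space \<Phi> \<and>
       k_continuous_map (prod_topology X conv_seq_space) \<Phi>
       \<longrightarrow> continuous_map (prod_topology X conv_seq_space) euclideanreal \<Phi>"
  show "sequentially_ascoli_space X"
    unfolding sequentially_ascoli_space_def
  proof (intro allI impI, elim conjE)
    fix f :: "nat \<Rightarrow> 'a \<Rightarrow> real" and g
    assume "\<forall>n. f n \<in> cont_funs X"
      and lim: "limitin (compact_open_topology X) f g sequentially"
    then have f: "\<And>n. f n \<in> cont_funs X" by blast
    let ?H = "(\<lambda>t x. seq_extension f g (x, t)) ` topspace conv_seq_space"
    have "continuous_map (prod_topology X conv_seq_space) euclideanreal (seq_extension f g)"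
      using R separately_continuous_map_seq_extension[OF f lim]
        k_continuous_map_seq_extension[OF f lim] by blast
    then have "equicontinuous_in X ?H"
      by (rule equicontinuous_in_sections[OF compact_space_conv_seq_space])
    moreover have "f n \<in> ?H" for n
    proof (rule image_eqI)
      \<comment> \<open>This is an equality of functions on the whole type:
        \<open>seq_extension\<close> evaluates \<open>f n\<close> at every point, also outside
        \<open>topspace X\<close>, so no restriction is involved.\<close>
      show "f n = (\<lambda>x. seq_extension f g (x, 1 / real (Suc n)))"
        by (simp only: seq_extension_inverse_Suc)
    qed (rule inverse_Suc_in_conv_seq_space)
    then have "range f \<subseteq> ?H"
      by (rule image_subsetI)
    ultimately show "equicontinuous_in X (range f)"
      by (rule equicontinuous_in_subset)
  qed
qed

end
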